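(* Let $\lambda_A,\lambda_B,\lambda_C>0$. Consider the continuous-time Markov chain on the state space $\mathbb{Z}\cup\{1'\}$ with the following transition rates (and no others): - for every integer $i\ge 0$: $i\to i+1$ at rate $\lambda_A$, and $i+1\to i$ at rate $\lambda_B+\lambda_C$; - for every integer $i\ge 0$: $-i\to -(i+1)$ at rate $\lambda_B$, and $-(i+1)\to -i$ at rate $\lambda_A+\lambda_C$; - $0\to 1'$ at rate $\lambda_C$, and $1'\to 0$ at rate $\lambda_A+\lambda_B+\lambda_C$. This chain is positive recurrent if and only if $$\lambda_C>|\lambda_A-\lambda_B|.$$
   Context: The chain models matchmaking for a 1v1 game with two sides A and B. Players insisting on side A, players insisting on side B, and choice-free players (who accept either side) arrive as independent Poisson processes of rates $\lambda_A$, $\lambda_B$, $\lambda_C$, and two players are matched as soon as they can take opposite sides. State $i>0$ means that $i$ players choosing side A are waiting, state $-i<0$ means that $i$ players choosing side B are waiting, state $0$ means that the queue is empty, and state $1'$ means that one choice-free player is waiting. *)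

theory Defs
  imports "HOL-Probability.Probability" "HOL-Library.Countable"
begin

section \<open>Continuous-time Markov chains given by transition rates\<close>

text \<open>
  A rate function \<open>q\<close> gives the rate \<open>q x y\<close> of the transition \<open>x \<rightarrow> y\<close> for \<open>x \<noteq> y\<close>;
  its diagonal values are ignored.  The rates out of every state are meant to be nonnegative
  and summable.
\<close>

definition exit_rate :: "('s \<Rightarrow> 's \<Rightarrow> real) \<Rightarrow> 's \<Rightarrow> real" where
  "exit_rate q x = (\<Sum>\<^sub>\<infinity>y\<in>-{x}. q x y)"

definition jump_pmf :: "('s \<Rightarrow> 's \<Rightarrow> real) \<Rightarrow> 's \<Rightarrow> 's pmf" where
  "jump_pmf q x =
     (if exit_rate q x = 0 then return_pmf x
      else embed_pmf (\<lambda>y. if y = x then 0 else q x y / exit_rate q x))"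

text \<open>
  The chain is built from its jump chain and its holding times.  A sample point consists of
  independent random variables: for every step \<open>n\<close> and state \<open>x\<close> the state that follows \<open>x\<close>
  if the chain is in \<open>x\<close> after \<open>n\<close> jumps, and for every \<open>n\<close> an \<open>Exp(1)\<close> variable, which
  divided by the exit rate of the state after \<open>n\<close> jumps is the holding time there.
  Hence the jump chain is a discrete-time Markov chain with transition probabilities \<open>jump_pmf q\<close>
  and, given the jump chain, the holding times are independent and exponential with the
  exit rates as parameters; this is lemma \<open>emeasure_jump_chain_holding_time\<close> below.
\<close>

definition ctmc_space ::
  "('s \<Rightarrow> 's \<Rightarrow> real) \<Rightarrow> ((nat \<times> 's \<Rightarrow> 's) \<times> (nat \<Rightarrow> real)) measure" where
  "ctmc_space q =
     PiM UNIV (\<lambda>(n, x). measure_pmf (jump_pmf q x)) \<Otimes>\<^sub>M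
     PiM UNIV (\<lambda>n. density lborel (exponential_density 1))"

primrec jump_chain :: "'s \<Rightarrow> (nat \<times> 's \<Rightarrow> 's) \<times> (nat \<Rightarrow> real) \<Rightarrow> nat \<Rightarrow> 's" where
  "jump_chain x \<omega> 0 = x"
| "jump_chain x \<omega> (Suc n) = fst \<omega> (n, jump_chain x \<omega> n)"

text \<open>In \<open>ennreal\<close>, division by the exit rate \<open>0\<close> of an absorbing state gives \<open>\<infinity>\<close>.\<close>

definition holding_time ::
  "('s \<Rightarrow> 's \<Rightarrow> real) \<Rightarrow> 's \<Rightarrow> (nat \<times> 's \<Rightarrow> 's) \<times> (nat \<Rightarrow> real) \<Rightarrow> nat \<Rightarrow> ennreal" where
  "holding_time q x \<omega> n = ennreal (snd \<omega> n) / ennreal (exit_rate q (jump_chain x \<omega> n))"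

definition jump_time ::
  "('s \<Rightarrow> 's \<Rightarrow> real) \<Rightarrow> 's \<Rightarrow> (nat \<times> 's \<Rightarrow> 's) \<times> (nat \<Rightarrow> real) \<Rightarrow> nat \<Rightarrow> ennreal" where
  "jump_time q x \<omega> n = (\<Sum>k<n. holding_time q x \<omega> k)"

text \<open>
  The (minimal) chain started in \<open>x\<close>: it is in its state after \<open>n\<close> jumps during the interval
  from the \<open>n\<close>-th jump time (included) to the next one (excluded), and in the cemetery \<open>None\<close>
  after an explosion.
\<close>

definition ctmc ::
  "('s \<Rightarrow> 's \<Rightarrow> real) \<Rightarrow> 's \<Rightarrow> (nat \<times> 's \<Rightarrow> 's) \<times> (nat \<Rightarrow> real) \<Rightarrow> ennreal \<Rightarrow> 's option" where
  "ctmc q x \<omega> t =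
     (if \<exists>n. t < jump_time q x \<omega> (Suc n)
      then Some (jump_chain x \<omega> (LEAST n. t < jump_time q x \<omega> (Suc n)))
      else None)"

text \<open>The first return to the initial state after the first jump; \<open>\<infinity>\<close> if there is none.\<close>

definition return_time ::
  "('s \<Rightarrow> 's \<Rightarrow> real) \<Rightarrow> 's \<Rightarrow> (nat \<times> 's \<Rightarrow> 's) \<times> (nat \<Rightarrow> real) \<Rightarrow> ennreal" where
  "return_time q x \<omega> = Inf {t. jump_time q x \<omega> 1 \<le> t \<and> ctmc q x \<omega> t = Some x}"

definition positive_recurrent_state :: "('s \<Rightarrow> 's \<Rightarrow> real) \<Rightarrow> 's \<Rightarrow> bool" where
  "positive_recurrent_state q x \<longleftrightarrow>
     exit_rate q x = 0 \<or> (\<integral>\<^sup>+\<omega>. return_time q x \<omega> \<partial>ctmc_space q) < \<infinity>"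

definition positive_recurrent :: "('s \<Rightarrow> 's \<Rightarrow> real) \<Rightarrow> bool" where
  "positive_recurrent q \<longleftrightarrow> (\<forall>x. positive_recurrent_state q x)"


lemma pmf_jump_pmf:
  assumes nonneg: "\<And>y. y \<noteq> x \<Longrightarrow> 0 \<le> q x y" and summable: "q x summable_on - {x}"
    and pos: "0 < exit_rate q x"
  shows "pmf (jump_pmf q x) y = (if y = x then 0 else q x y / exit_rate q x)"
proof -
  let ?f = "\<lambda>y. if y = x then 0 else q x y / exit_rate q x"
  have f_nonneg: "0 \<le> ?f y" for y
    using nonneg pos by simp
  have "(q x has_sum exit_rate q x) (- {x})"
    using summable by (simp add: exit_rate_def)
  then have "((\<lambda>y. q x y * (1 / exit_rate q x)) has_sum exit_rate q x * (1 / exit_rate q x)) (- {x})"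
    by (rule has_sum_cmult_left)
  then have "((\<lambda>y. q x y / exit_rate q x) has_sum 1) (- {x})"
    using pos by simp
  then have sum1: "(?f has_sum 1) UNIV"
    by (subst has_sum_cong_neutral[where T="- {x}" and g="\<lambda>y. q x y / exit_rate q x"]) auto
  then have "?f summable_on UNIV"
    by (auto simp: summable_on_def)
  then have abs: "Infinite_Set_Sum.abs_summable_on ?f UNIV"
    using f_nonneg by (subst abs_summable_equivalent[symmetric]) simp
  have "(\<integral>\<^sup>+y. ennreal (?f y) \<partial>count_space UNIV) = ennreal (infsetsum ?f UNIV)"
    by (intro nn_integral_conv_infsetsum abs f_nonneg)
  also have "infsetsum ?f UNIV = 1"
    using infsetsum_infsum[OF abs] sum1 by (simp add: infsumI)
  finally have "pmf (embed_pmf ?f) y = ?f y"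
    by (intro pmf_embed_pmf f_nonneg) simp
  then show ?thesis
    using pos by (simp add: jump_pmf_def)
qed

lemma less_holding_time_iff:
  assumes "0 < exit_rate q (jump_chain x \<omega> n)" and "0 \<le> t"
  shows "ennreal t < holding_time q x \<omega> n \<longleftrightarrow> exit_rate q (jump_chain x \<omega> n) * t < snd \<omega> n"
proof (cases "0 \<le> snd \<omega> n")
  case True
  then show ?thesis
    using assms by (simp add: holding_time_def divide_ennreal ennreal_less_iff field_simps)
next
  case False
  moreover have "0 \<le> exit_rate q (jump_chain x \<omega> n) * t"
    using assms by simp
  ultimately have "\<not> exit_rate q (jump_chain x \<omega> n) * t < snd \<omega> n"
    by linarith
  with False show ?thesis
    by (simp add: holding_time_def ennreal_neg)
qed

lemma emeasure_exponential_greater: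
  assumes "0 \<le> t"
  shows "emeasure (density lborel (exponential_density 1)) {t<..} = ennreal (exp (- t))"
proof -
  interpret E: prob_space "density lborel (exponential_density 1)"
    by (rule prob_space_exponential_density) simp
  have "distributed (density lborel (exponential_density 1)) lborel (\<lambda>x. x) (exponential_density 1)"
    by (auto simp: distributed_def distr_id2)
  from E.exponential_distributedD_gt[OF this assms]
  have "measure (density lborel (exponential_density 1)) {t<..} = exp (- t)"
    by (simp add: greaterThan_def)
  then show ?thesis
    by (simp add: E.emeasure_eq_measure)
qed

lemma emeasure_jump_chain_holding_time:
  assumes pos: "\<And>i. i \<le> n \<Longrightarrow> 0 < exit_rate q (y i)" and t: "\<And>i. i \<le> n \<Longrightarrow> 0 \<le> t i"
  shows "emeasure (ctmc_space q)
           {\<omega> \<in> space (ctmc_space q). \<forall>i\<le>n. jump_chain (y 0) \<omega> i = y i \<and>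
              ennreal (t i) < holding_time q (y 0) \<omega> i} =
         (\<Prod>i<n. ennreal (pmf (jump_pmf q (y i)) (y (Suc i)))) *
         (\<Prod>i\<le>n. ennreal (exp (- (exit_rate q (y i) * t i))))"
proof -
  let ?J = "PiM UNIV (\<lambda>(n :: nat, x). measure_pmf (jump_pmf q x))"
  let ?H = "PiM UNIV (\<lambda>n :: nat. density lborel (exponential_density 1))"
  interpret J: product_prob_space "\<lambda>(n :: nat, x). measure_pmf (jump_pmf q x)" UNIV
    by (auto simp: product_prob_space_def product_prob_space_axioms_def product_sigma_finite_def
        intro!: prob_space_imp_sigma_finite measure_pmf.prob_space_axioms)
  interpret H: product_prob_space "\<lambda>n :: nat. density lborel (exponential_density 1)" UNIV
    by (auto simp: product_prob_space_def product_prob_space_axioms_def product_sigma_finite_def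
        intro!: prob_space_imp_sigma_finite prob_space_exponential_density)
  define A where "A = {f \<in> space ?J. \<forall>p\<in>(\<lambda>i. (i, y i)) ` {..<n}. f p \<in> {y (Suc (fst p))}}"
  define B where "B = {s \<in> space ?H. \<forall>i\<in>{..n}. s i \<in> {exit_rate q (y i) * t i<..}}"
  have A_sets: "A \<in> sets ?J"
    unfolding A_def by (intro sets.sets_Collect_finite_All sets_Collect_single') auto
  have B_sets: "B \<in> sets ?H"
    unfolding B_def by (intro sets.sets_Collect_finite_All sets_Collect_single') auto
  have path: "(\<forall>i\<le>n. jump_chain (y 0) \<omega> i = y i) \<longleftrightarrow> (\<forall>i<n. fst \<omega> (i, y i) = y (Suc i))" for \<omega>
  proof
    assume *: "\<forall>i\<le>n. jump_chain (y 0) \<omega> i = y i"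
    show "\<forall>i<n. fst \<omega> (i, y i) = y (Suc i)"
    proof (intro allI impI)
      fix i assume "i < n"
      then have "jump_chain (y 0) \<omega> i = y i" "jump_chain (y 0) \<omega> (Suc i) = y (Suc i)"
        using * by (metis less_imp_le, metis Suc_leI)
      then show "fst \<omega> (i, y i) = y (Suc i)"
        by simp
    qed
  next
    assume *: "\<forall>i<n. fst \<omega> (i, y i) = y (Suc i)"
    have "i \<le> n \<longrightarrow> jump_chain (y 0) \<omega> i = y i" for i
      using * by (induction i) auto
    then show "\<forall>i\<le>n. jump_chain (y 0) \<omega> i = y i"
      by blast
  qed
  have "{\<omega> \<in> space (ctmc_space q). \<forall>i\<le>n. jump_chain (y 0) \<omega> i = y i \<and>
            ennreal (t i) < holding_time q (y 0) \<omega> i} =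
        {\<omega> \<in> space (ctmc_space q). (\<forall>i\<le>n. jump_chain (y 0) \<omega> i = y i) \<and>
            (\<forall>i\<le>n. exit_rate q (y i) * t i < snd \<omega> i)}"
    using pos t by (auto simp: less_holding_time_iff)
  also have "\<dots> = A \<times> B"
    unfolding path by (auto simp: A_def B_def ctmc_space_def space_pair_measure)
  finally have "emeasure (ctmc_space q)
           {\<omega> \<in> space (ctmc_space q). \<forall>i\<le>n. jump_chain (y 0) \<omega> i = y i \<and>
              ennreal (t i) < holding_time q (y 0) \<omega> i} = emeasure ?J A * emeasure ?H B"
    using A_sets B_sets by (simp add: ctmc_space_def H.emeasure_pair_measure_Times)
  also have "emeasure ?J A =
      (\<Prod>p\<in>(\<lambda>i. (i, y i)) ` {..<n}. emeasure (case p of (n, x) \<Rightarrow> measure_pmf (jump_pmf q x)) {y (Suc (fst p))})"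
    unfolding A_def by (rule J.emeasure_PiM_Collect) auto
  also have "\<dots> = (\<Prod>i<n. ennreal (pmf (jump_pmf q (y i)) (y (Suc i))))"
    by (subst prod.reindex) (auto simp: inj_on_def emeasure_pmf_single)
  also have "emeasure ?H B = (\<Prod>i\<le>n. ennreal (exp (- (exit_rate q (y i) * t i))))"
    unfolding B_def using pos t
    by (subst H.emeasure_PiM_Collect)
      (auto simp: less_imp_le intro!: prod.cong emeasure_exponential_greater)
  finally show ?thesis .
qed

lemma mono_jump_time: "mono (jump_time q x \<omega>)"
  unfolding jump_time_def by (auto intro!: monoI sum_mono2)

lemma return_time_eq_INF:
  "return_time q x \<omega> =
     (INF n\<in>{1..}. if jump_chain x \<omega> n = x \<and> jump_time q x \<omega> n < jump_time q x \<omega> (Suc n)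
                 then jump_time q x \<omega> n else \<infinity>)" (is "_ = ?R")
proof (rule antisym)
  show "return_time q x \<omega> \<le> ?R"
  proof (rule INF_greatest)
    fix n :: nat assume n: "n \<in> {1..}"
    show "return_time q x \<omega> \<le>
      (if jump_chain x \<omega> n = x \<and> jump_time q x \<omega> n < jump_time q x \<omega> (Suc n)
       then jump_time q x \<omega> n else \<infinity>)"
    proof (cases "jump_chain x \<omega> n = x \<and> jump_time q x \<omega> n < jump_time q x \<omega> (Suc n)")
      case True
      have "(LEAST k. jump_time q x \<omega> n < jump_time q x \<omega> (Suc k)) = n"
      proof (rule Least_equality)
        show "n \<le> k" if "jump_time q x \<omega> n < jump_time q x \<omega> (Suc k)" for k
          using that monoD[OF mono_jump_time, of "Suc k" n q x \<omega>] by (meson not_less not_less_eq_eq)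
      qed (use True in simp)
      then have "ctmc q x \<omega> (jump_time q x \<omega> n) = Some x"
        using True by (auto simp: ctmc_def)
      moreover have "jump_time q x \<omega> 1 \<le> jump_time q x \<omega> n"
        using n by (intro monoD[OF mono_jump_time]) simp
      ultimately show ?thesis
        using True by (auto simp: return_time_def intro: Inf_lower)
    next
      case False
      then show ?thesis
        by (subst if_not_P) auto
    qed
  qed
  show "?R \<le> return_time q x \<omega>"
    unfolding return_time_def
  proof (rule Inf_greatest, clarify)
    fix t assume t: "jump_time q x \<omega> 1 \<le> t" "ctmc q x \<omega> t = Some x"
    then have ex: "\<exists>n. t < jump_time q x \<omega> (Suc n)"
      by (auto simp: ctmc_def split: if_splits)
    define m where "m = (LEAST n. t < jump_time q x \<omega> (Suc n))"
    have m: "t < jump_time q x \<omega> (Suc m)"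
      unfolding m_def using ex by (rule LeastI_ex)
    have x: "jump_chain x \<omega> m = x"
      using t ex by (simp add: ctmc_def m_def)
    have "m \<noteq> 0"
    proof
      assume "m = 0"
      then have "t < jump_time q x \<omega> 1"
        using m by (simp only: One_nat_def)
      with t(1) show False
        by (rule leD[THEN notE])
    qed
    then obtain k where k: "m = Suc k"
      using not0_implies_Suc by blast
    then have "\<not> t < jump_time q x \<omega> (Suc k)"
      unfolding m_def by (intro not_less_Least) simp
    then have le: "jump_time q x \<omega> m \<le> t"
      by (simp only: k not_less)
    let ?g = "\<lambda>n. if jump_chain x \<omega> n = x \<and> jump_time q x \<omega> n < jump_time q x \<omega> (Suc n)
       then jump_time q x \<omega> n else \<infinity>"
    have "m \<in> {1..}"
      by (simp add: k)
    then have "?R \<le> ?g m"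
      by (rule INF_lower[where f = ?g])
    also have "?g m = jump_time q x \<omega> m"
      using x le_less_trans[OF le m] by (simp only: simp_thms if_True)
    also note le
    finally show "?R \<le> t" .
  qed
qed

lemma measurable_jump_chain [measurable]:
  fixes q :: "'s::countable \<Rightarrow> 's \<Rightarrow> real"
  shows "(\<lambda>\<omega>. jump_chain x \<omega> n) \<in> ctmc_space q \<rightarrow>\<^sub>M count_space UNIV"
proof (induction n)
  case (Suc n)
  have "(\<lambda>\<omega>. fst \<omega> (n, y)) \<in> ctmc_space q \<rightarrow>\<^sub>M count_space UNIV" for y
  proof -
    have "(\<lambda>f. f (n, y)) \<in> PiM UNIV (\<lambda>(n :: nat, x). measure_pmf (jump_pmf q x)) \<rightarrow>\<^sub>M
        measure_pmf (jump_pmf q y)"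
      using measurable_component_singleton[of "(n, y)" UNIV
        "\<lambda>(n, x). measure_pmf (jump_pmf q x)"] by simp
    then have "(\<lambda>\<omega>. fst \<omega> (n, y)) \<in> ctmc_space q \<rightarrow>\<^sub>M measure_pmf (jump_pmf q y)"
      unfolding ctmc_space_def by (rule measurable_compose[OF measurable_fst])
    then show ?thesis
      by (simp cong: measurable_cong_sets)
  qed
  from measurable_compose_countable[OF this Suc] show ?case
    by (simp only: jump_chain.simps)
qed simp

lemma measurable_holding_time [measurable]:
  fixes q :: "'s::countable \<Rightarrow> 's \<Rightarrow> real"
  shows "(\<lambda>\<omega>. holding_time q x \<omega> n) \<in> borel_measurable (ctmc_space q)"
proof -
  have [measurable]: "(\<lambda>\<omega>. snd \<omega> n) \<in> borel_measurable (ctmc_space q)"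
    unfolding ctmc_space_def
    using measurable_compose[OF measurable_snd
      measurable_component_singleton[of n UNIV "\<lambda>n. density lborel (exponential_density 1)"]]
    by (simp cong: measurable_cong_sets)
  show ?thesis
    unfolding holding_time_def by measurable
qed

lemma measurable_return_time [measurable]:
  fixes q :: "'s::countable \<Rightarrow> 's \<Rightarrow> real"
  shows "return_time q x \<in> borel_measurable (ctmc_space q)"
proof -
  have [measurable]: "(\<lambda>\<omega>. jump_time q x \<omega> n) \<in> borel_measurable (ctmc_space q)" for n
    unfolding jump_time_def by measurable
  show ?thesis
    unfolding return_time_eq_INF[abs_def] by measurable
qed


section \<open>The matchmaking chain\<close>

text \<open>The state \<open>Waiting i\<close> is the integer \<open>i\<close>, and \<open>Choice_Free\<close> is the state \<open>1'\<close>.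
  The parameters \<open>a\<close>, \<open>b\<close>, \<open>c\<close> are the arrival rates of the players insisting on side A, the
  players insisting on side B, and the choice-free players.\<close>

datatype queue_state = Waiting int | Choice_Free

instance queue_state :: countable
  by countable_datatype

fun queue_rate :: "real \<Rightarrow> real \<Rightarrow> real \<Rightarrow> queue_state \<Rightarrow> queue_state \<Rightarrow> real" where
  "queue_rate a b c (Waiting i) (Waiting j) =
     (if j = i + 1 then (if i \<ge> 0 then a else a + c)
      else if j = i - 1 then (if i \<le> 0 then b else b + c)
      else 0)"
| "queue_rate a b c (Waiting i) Choice_Free = (if i = 0 then c else 0)"
| "queue_rate a b c Choice_Free (Waiting j) = (if j = 0 then a + b + c else 0)"
| "queue_rate a b c Choice_Free Choice_Free = 0"

end

(*
All states have the same exit rate, so up to that factor the expected return time is the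
expected return time of the jump chain, i.e. the sum over n of the probabilities that the first
n jumps do not lead back to the initial state.

If c > |a - b|, both half-lines have drift towards 0.  A function that is linear on one half-line
and geometric on the other (steep enough to absorb the wrong drift there) is a Foster-Lyapunov
function for hitting any prescribed state, so all expected return times are finite.

If, say, a >= b + c, the positive part of the state, stopped at the return to 0, is a
submartingale with positive mean at time 1, and it is at most n after n jumps.  Hence the
probability of no return within n jumps is at least const / n, and the harmonic series diverges.
*)
theory Submission
  imports Defs
begin

section \<open>The jump chain and its history\<close>

text \<open>The most recent state comes first.\<close>

primrec history :: "'s \<Rightarrow> (nat \<times> 's \<Rightarrow> 's) \<times> (nat \<Rightarrow> real) \<Rightarrow> nat \<Rightarrow> 's list" where
  "history x \<omega> 0 = [x]"
| "history x \<omega> (Suc n) = jump_chain x \<omega> (Suc n) # history x \<omega> n"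

text \<open>The event that the first return takes more than \<open>n\<close> jumps; the initial
  visit at time 0 does not count. Summed over \<open>n\<close>, its indicators give the number of
  jumps up to the first return.\<close>

definition no_return :: "'s \<Rightarrow> (nat \<times> 's \<Rightarrow> 's) \<times> (nat \<Rightarrow> real) \<Rightarrow> nat \<Rightarrow> bool" where
  "no_return x \<omega> n \<longleftrightarrow> (\<forall>k\<in>{1..n}. jump_chain x \<omega> k \<noteq> x)"

lemma history_not_Nil [simp]: "history x \<omega> n \<noteq> []"
  by (cases n) auto

lemma hd_history [simp]: "hd (history x \<omega> n) = jump_chain x \<omega> n"
  by (cases n) auto

lemma length_history [simp]: "length (history x \<omega> n) = Suc n"
  by (induction n) auto

lemma last_history [simp]: "last (history x \<omega> n) = x"
  by (induction n) auto

lemma nth_rev_history: "k \<le> n \<Longrightarrow> rev (history x \<omega> n) ! k = jump_chain x \<omega> k"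
  by (induction n) (auto simp: nth_append le_Suc_eq)

lemma history_eq_iff:
  assumes "length l = Suc n"
  shows "history x \<omega> n = l \<longleftrightarrow> (\<forall>k\<le>n. jump_chain x \<omega> k = rev l ! k)"
proof -
  have "history x \<omega> n = l \<longleftrightarrow> rev (history x \<omega> n) = rev l"
    by simp
  also have "\<dots> \<longleftrightarrow> (\<forall>k<Suc n. rev (history x \<omega> n) ! k = rev l ! k)"
    using assms by (subst list_eq_iff_nth_eq) simp
  also have "\<dots> \<longleftrightarrow> (\<forall>k\<le>n. jump_chain x \<omega> k = rev l ! k)"
    by (simp add: less_Suc_eq_le nth_rev_history)
  finally show ?thesis .
qed

lemma no_return_0 [simp]: "no_return x \<omega> 0"
  by (simp add: no_return_def)

lemma no_return_Suc: "no_return x \<omega> (Suc n) \<longleftrightarrow> no_return x \<omega> n \<and> jump_chain x \<omega> (Suc n) \<noteq> x"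
  by (auto simp: no_return_def atLeastAtMostSuc_conv simp del: jump_chain.simps)

text \<open>The initial state sits at the end of the history, so \<open>butlast\<close> removes
  exactly the visit at time 0. The event thus becomes a function of the history, to which the Markov
  property applies.\<close>

lemma no_return_iff_history: "no_return x \<omega> n \<longleftrightarrow> x \<notin> set (butlast (history x \<omega> n))"
  by (induction n) (auto simp: no_return_Suc)

lemma no_return_jump_chain: "no_return x \<omega> n \<Longrightarrow> 0 < n \<Longrightarrow> jump_chain x \<omega> n \<noteq> x"
  by (auto simp: no_return_def)

lemma measurable_history [measurable]:
  fixes q :: "'s::countable \<Rightarrow> 's \<Rightarrow> real"
  shows "(\<lambda>\<omega>. history x \<omega> n) \<in> ctmc_space q \<rightarrow>\<^sub>M count_space UNIV"
proof (induction n)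
  case (Suc n)
  have "(\<lambda>\<omega>. jump_chain x \<omega> (Suc n) # l) \<in> ctmc_space q \<rightarrow>\<^sub>M count_space UNIV" for l
    by (rule measurable_compose[OF measurable_jump_chain]) simp
  from measurable_compose_countable[OF this Suc] show ?case
    by (simp only: history.simps)
qed simp

lemma measurable_no_return [measurable]:
  fixes q :: "'s::countable \<Rightarrow> 's \<Rightarrow> real"
  shows "Measurable.pred (ctmc_space q) (\<lambda>\<omega>. no_return x \<omega> n)"
  unfolding no_return_def by measurable

text \<open>Point masses determine a law on a countable set; this turns path probabilities into
  integrals.\<close>

lemma nn_integral_countable_distr:
  fixes Z :: "'a \<Rightarrow> 'b::countable"
  assumes [measurable]: "Z \<in> M \<rightarrow>\<^sub>M count_space UNIV"
  shows "(\<integral>\<^sup>+\<omega>. f (Z \<omega>) \<partial>M) =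
    (\<integral>\<^sup>+z. emeasure M {\<omega>\<in>space M. Z \<omega> = z} * f z \<partial>count_space UNIV)"
proof -
  have "distr M (count_space UNIV) Z =
      density (count_space UNIV) (\<lambda>z. emeasure M {\<omega>\<in>space M. Z \<omega> = z})"
    by (rule measure_eqI_countable[where A = UNIV])
      (auto simp: emeasure_distr emeasure_density nn_integral_count_space_indicator[symmetric]
        intro!: arg_cong[where f = "emeasure M"])
  then have "(\<integral>\<^sup>+z. f z \<partial>distr M (count_space UNIV) Z) =
    (\<integral>\<^sup>+z. emeasure M {\<omega>\<in>space M. Z \<omega> = z} * f z \<partial>count_space UNIV)"
    by (simp add: nn_integral_density)
  then show ?thesis
    by (simp add: nn_integral_distr)
qed

section \<open>Exponential clocks and their independence of the jump chain\<close>

abbreviation exp_product :: "(nat \<Rightarrow> real) measure" where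
  "exp_product \<equiv> PiM UNIV (\<lambda>n. density lborel (exponential_density 1))"

abbreviation jump_product :: "('s \<Rightarrow> 's \<Rightarrow> real) \<Rightarrow> (nat \<times> 's \<Rightarrow> 's) measure" where
  "jump_product q \<equiv> PiM UNIV (\<lambda>(n, x). measure_pmf (jump_pmf q x))"

lemma prob_space_exp_product: "prob_space exp_product"
  by (intro prob_space_PiM prob_space_exponential_density) simp

lemma prob_space_jump_product: "prob_space (jump_product q)"
  by (intro prob_space_PiM) (auto intro: measure_pmf.prob_space_axioms)

lemma prob_space_ctmc_space: "prob_space (ctmc_space q)"
  unfolding ctmc_space_def
  using prob_space_jump_product prob_space_exp_product by (rule prob_space_pair)

lemma measurable_exp_clock [measurable]: "(\<lambda>\<omega>. snd \<omega> n) \<in> borel_measurable (ctmc_space q)"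
  unfolding ctmc_space_def
  using measurable_compose[OF measurable_snd
    measurable_component_singleton[of n UNIV "\<lambda>n. density lborel (exponential_density 1)"]]
  by (simp cong: measurable_cong_sets)

text \<open>\<open>return_time\<close> sees only visits of positive duration, so samples with a
  nonpositive clock are set aside as a null set.\<close>

lemma AE_exp_clock_pos: "AE \<omega> in ctmc_space q. \<forall>n. 0 < snd \<omega> n"
proof -
  interpret H: prob_space exp_product
    by (rule prob_space_exp_product)
  interpret J: prob_space "jump_product q"
    by (rule prob_space_jump_product)
  interpret pair_sigma_finite "jump_product q" exp_product ..
  interpret E: prob_space "density lborel (exponential_density 1)"
    by (rule prob_space_exponential_density) simp
  have "AE s in density lborel (exponential_density 1). s \<in> {0<..}"
    using emeasure_exponential_greater[of 0]
    by (intro E.AE_prob_1) (simp add: E.emeasure_eq_measure)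
  then have "AE s in density lborel (exponential_density 1). 0 < s"
    by simp
  then have "AE s in exp_product. 0 < s n" for n
    by (intro AE_PiM_component[where M = "\<lambda>_. density lborel (exponential_density 1)"]
        E.prob_space_axioms) auto
  then have *: "AE s in exp_product. \<forall>n. 0 < s n"
    by (simp add: AE_all_countable)
  have "{\<omega> \<in> space (ctmc_space q). \<forall>n. 0 < snd \<omega> n} \<in> sets (ctmc_space q)"
    by measurable
  then show ?thesis
    unfolding ctmc_space_def by (rule AE_pair_measure) (use * in simp)
qed

lemma nn_integral_exp_clock:
  "(\<integral>\<^sup>+s. ennreal (s n) \<partial>exp_product) = 1"
proof -
  interpret E: prob_space "density lborel (exponential_density 1)"
    by (rule prob_space_exponential_density) simp
  have "(\<integral>\<^sup>+s. ennreal (s n) \<partial>exp_product) =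
      (\<integral>\<^sup>+s. ennreal s \<partial>distr exp_product (density lborel (exponential_density 1)) (\<lambda>s. s n))"
    by (subst nn_integral_distr) auto
  also have "distr exp_product (density lborel (exponential_density 1)) (\<lambda>s. s n) =
      density lborel (exponential_density 1)"
    by (rule distr_PiM_component) (auto intro: E.prob_space_axioms)
  also have "(\<integral>\<^sup>+s. ennreal s \<partial>density lborel (exponential_density 1)) =
      (\<integral>\<^sup>+s. ennreal (exponential_density 1 s * s ^ 1) \<partial>lborel)"
    by (subst nn_integral_density) (auto simp: ennreal_mult' intro!: nn_integral_cong)
  also have "\<dots> = 1"
    by (subst nn_integral_erlang_ith_moment) auto
  finally show ?thesis .
qed

text \<open>\<open>P\<close> looks only at the jump component of the product space. By Tonelli the
  clock integrates out first and contributes its mean 1.\<close>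

lemma nn_integral_exp_clock_independent:
  assumes [measurable]: "Measurable.pred (ctmc_space q) P"
    and P: "\<And>f s t. P (f, s) \<longleftrightarrow> P (f, t)"
  shows "(\<integral>\<^sup>+\<omega>. ennreal (snd \<omega> n) * indicator {\<omega>. P \<omega>} \<omega> \<partial>ctmc_space q) =
    emeasure (ctmc_space q) {\<omega>\<in>space (ctmc_space q). P \<omega>}"
proof -
  interpret H: prob_space exp_product
    by (rule prob_space_exp_product)
  have meas1: "(\<lambda>\<omega>. ennreal (snd \<omega> n) * indicator {\<omega>. P \<omega>} \<omega>) \<in> borel_measurable (ctmc_space q)"
    and meas2: "(\<lambda>\<omega>. indicator {\<omega>. P \<omega>} \<omega> :: ennreal) \<in> borel_measurable (ctmc_space q)"
    by measurable
  have [measurable]: "(\<lambda>s. s n) \<in> borel_measurable exp_product"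
    using measurable_component_singleton[of n UNIV "\<lambda>n. density lborel (exponential_density 1)"]
    by (simp cong: measurable_cong_sets)
  have ind: "indicator {\<omega>. P \<omega>} (f, s) = (indicator {f. P (f, undefined)} f :: ennreal)" for f s
    using P[of f s undefined] by (simp add: indicator_def)
  have "(\<integral>\<^sup>+\<omega>. ennreal (snd \<omega> n) * indicator {\<omega>. P \<omega>} \<omega> \<partial>ctmc_space q) =
    (\<integral>\<^sup>+f. \<integral>\<^sup>+s. ennreal (s n) * indicator {\<omega>. P \<omega>} (f, s) \<partial>exp_product \<partial>jump_product q)"
    using H.nn_integral_fst[OF meas1[unfolded ctmc_space_def]] by (simp add: ctmc_space_def)
  also have "\<dots> = (\<integral>\<^sup>+f. \<integral>\<^sup>+s. indicator {\<omega>. P \<omega>} (f, s) \<partial>exp_product \<partial>jump_product q)"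
    by (simp add: ind nn_integral_multc nn_integral_exp_clock H.emeasure_space_1)
  also have "\<dots> = (\<integral>\<^sup>+\<omega>. indicator {\<omega>. P \<omega>} \<omega> \<partial>ctmc_space q)"
    using H.nn_integral_fst[OF meas2[unfolded ctmc_space_def]] by (simp add: ctmc_space_def)
  also have "\<dots> = emeasure (ctmc_space q) {\<omega>\<in>space (ctmc_space q). P \<omega>}"
    by (simp flip: nn_integral_indicator) (auto intro!: nn_integral_cong simp: indicator_def)
  finally show ?thesis .
qed

lemma jump_chain_cong: "fst \<omega> = fst \<omega>' \<Longrightarrow> jump_chain x \<omega> n = jump_chain x \<omega>' n"
  by (induction n) auto

lemma no_return_cong: "fst \<omega> = fst \<omega>' \<Longrightarrow> no_return x \<omega> n \<longleftrightarrow> no_return x \<omega>' n"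
  unfolding no_return_def using jump_chain_cong[of \<omega> \<omega>' x] by simp

section \<open>Chains with constant exit rate\<close>

text \<open>A common exit rate gives all holding times the same law, so continuous time enters the
  expected return time only through the factor \<open>1 / r\<close>.\<close>

locale uniform_rate_chain =
  fixes q :: "'s::countable \<Rightarrow> 's \<Rightarrow> real" and r :: real
  assumes rate_pos: "0 < r" and exit_rate_eq [simp]: "exit_rate q x = r"
begin

text \<open>Tail probabilities of the number of jumps until the first return; their sum is its
  expectation.\<close>

definition survival :: "'s \<Rightarrow> nat \<Rightarrow> ennreal" where
  "survival x n = emeasure (ctmc_space q) {\<omega>\<in>space (ctmc_space q). no_return x \<omega> n}"

section \<open>Markov property of the path\<close>

text \<open>With all time thresholds 0, \<open>emeasure_jump_chain_holding_time\<close> adds only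
  the almost sure event that the holding times are positive, and its exponential factors become
  1.\<close>

lemma emeasure_history:
  assumes "length l = Suc n" and "last l = x"
  shows "emeasure (ctmc_space q) {\<omega>\<in>space (ctmc_space q). history x \<omega> n = l} =
    (\<Prod>i<n. ennreal (pmf (jump_pmf q (rev l ! i)) (rev l ! Suc i)))"
proof -
  have x: "rev l ! 0 = x"
    using assms by (metis hd_conv_nth hd_rev list.size(3) nat.distinct(1) rev_is_Nil_conv)
  have [measurable]: "Measurable.pred (ctmc_space q)
      (\<lambda>\<omega>. \<forall>i\<le>n. jump_chain (rev l ! 0) \<omega> i = rev l ! i \<and>
        ennreal 0 < holding_time q (rev l ! 0) \<omega> i)"
    by measurable
  have "emeasure (ctmc_space q) {\<omega>\<in>space (ctmc_space q). history x \<omega> n = l} =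
    emeasure (ctmc_space q) {\<omega>\<in>space (ctmc_space q).
      \<forall>i\<le>n. jump_chain (rev l ! 0) \<omega> i = rev l ! i \<and>
        ennreal 0 < holding_time q (rev l ! 0) \<omega> i}"
  proof (rule emeasure_eq_AE)
    show "AE \<omega> in ctmc_space q. \<omega> \<in> {\<omega>\<in>space (ctmc_space q). history x \<omega> n = l} \<longleftrightarrow>
      \<omega> \<in> {\<omega>\<in>space (ctmc_space q). \<forall>i\<le>n. jump_chain (rev l ! 0) \<omega> i = rev l ! i \<and>
        ennreal 0 < holding_time q (rev l ! 0) \<omega> i}"
      using AE_exp_clock_pos
    proof eventually_elim
      case (elim \<omega>)
      then have "ennreal 0 < holding_time q x \<omega> i" for i
        by (subst less_holding_time_iff) (auto simp: rate_pos)
      then show ?case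
        by (auto simp: history_eq_iff[OF assms(1)] x)
    qed
  qed measurable
  also have "\<dots> = (\<Prod>i<n. ennreal (pmf (jump_pmf q (rev l ! i)) (rev l ! Suc i)))"
    using emeasure_jump_chain_holding_time[of n q "\<lambda>i. rev l ! i" "\<lambda>_. 0"]
    by (simp add: rate_pos)
  finally show ?thesis .
qed

lemma emeasure_history_Suc:
  "emeasure (ctmc_space q) {\<omega>\<in>space (ctmc_space q). history x \<omega> (Suc n) = z # l} =
   emeasure (ctmc_space q) {\<omega>\<in>space (ctmc_space q). history x \<omega> n = l} *
     ennreal (pmf (jump_pmf q (hd l)) z)"
proof (cases "length l = Suc n \<and> last l = x")
  case True
  then have ne: "l \<noteq> []"
    by auto
  have "rev l ! n = hd l"
    using True ne by (simp add: rev_nth hd_conv_nth)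
  moreover have "rev (z # l) ! i = rev l ! i" if "i \<le> n" for i
    using that True by (simp add: nth_append)
  moreover have "rev (z # l) ! Suc n = z"
    using True by (simp add: nth_append)
  ultimately show ?thesis
    using True ne by (subst (1 2) emeasure_history) (auto simp del: rev.simps history.simps)
next
  \<comment> \<open>A list of the wrong length or with another initial state is never a history, so
    both sides are 0.\<close>
  case False
  then have "history x \<omega> n \<noteq> l" for \<omega>
    by auto
  then have "{\<omega>\<in>space (ctmc_space q). history x \<omega> (Suc n) = z # l} = {}"
    "{\<omega>\<in>space (ctmc_space q). history x \<omega> n = l} = {}"
    by simp_all
  then show ?thesis
    by (simp only: emeasure_empty mult_zero_left)
qed

text \<open>Markov property in integral form. Keeping the whole history lets \<open>f\<close> record
  whether a return has already occurred.\<close>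

lemma nn_integral_history_Suc:
  "(\<integral>\<^sup>+\<omega>. f (history x \<omega> (Suc n)) \<partial>ctmc_space q) =
   (\<integral>\<^sup>+\<omega>. (\<integral>\<^sup>+z. f (z # history x \<omega> n) \<partial>measure_pmf (jump_pmf q (jump_chain x \<omega> n))) \<partial>ctmc_space q)"
proof -
  let ?p = "\<lambda>n l. emeasure (ctmc_space q) {\<omega>\<in>space (ctmc_space q). history x \<omega> n = l}"
  have [measurable]: "(\<lambda>\<omega>. (history x \<omega> n, jump_chain x \<omega> (Suc n))) \<in>
      ctmc_space q \<rightarrow>\<^sub>M count_space UNIV"
  proof -
    have "(\<lambda>\<omega>. (l, jump_chain x \<omega> (Suc n))) \<in> ctmc_space q \<rightarrow>\<^sub>M count_space UNIV" for l :: "'s list"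
      by (rule measurable_compose[OF measurable_jump_chain]) simp
    from measurable_compose_countable[OF this measurable_history] show ?thesis .
  qed
  have "(\<integral>\<^sup>+\<omega>. f (history x \<omega> (Suc n)) \<partial>ctmc_space q) =
    (\<integral>\<^sup>+\<omega>. (\<lambda>(l, z). f (z # l)) (history x \<omega> n, jump_chain x \<omega> (Suc n)) \<partial>ctmc_space q)"
    by simp
  also have "\<dots> = (\<integral>\<^sup>+p. emeasure (ctmc_space q)
      {\<omega>\<in>space (ctmc_space q). (history x \<omega> n, jump_chain x \<omega> (Suc n)) = p} *
      (\<lambda>(l, z). f (z # l)) p \<partial>count_space UNIV)"
    by (rule nn_integral_countable_distr) measurable
  also have "\<dots> = (\<integral>\<^sup>+p. (case p of (l, z) \<Rightarrow> ?p (Suc n) (z # l) * f (z # l)) \<partial>count_space UNIV)"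
    by (auto intro!: nn_integral_cong arg_cong2[where f = "(*)"] arg_cong2[where f = emeasure])
  also have "\<dots> = (\<integral>\<^sup>+l. \<integral>\<^sup>+z. ?p (Suc n) (z # l) * f (z # l) \<partial>count_space UNIV \<partial>count_space UNIV)"
    by (subst nn_integral_fst_count_space[symmetric]) simp
  also have "\<dots> = (\<integral>\<^sup>+l. ?p n l * (\<integral>\<^sup>+z. f (z # l) \<partial>measure_pmf (jump_pmf q (hd l))) \<partial>count_space UNIV)"
    by (simp only: emeasure_history_Suc nn_integral_measure_pmf mult.assoc)
      (simp add: nn_integral_cmult)
  also have "\<dots> = (\<integral>\<^sup>+\<omega>. (\<lambda>l. \<integral>\<^sup>+z. f (z # l) \<partial>measure_pmf (jump_pmf q (hd l))) (history x \<omega> n) \<partial>ctmc_space q)"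
    by (rule nn_integral_countable_distr[symmetric]) measurable
  finally show ?thesis
    by simp
qed

lemma nn_integral_jump_chain_Suc:
  "(\<integral>\<^sup>+\<omega>. g (jump_chain x \<omega> (Suc n)) * indicator {\<omega>. no_return x \<omega> n} \<omega> \<partial>ctmc_space q) =
   (\<integral>\<^sup>+\<omega>. (\<integral>\<^sup>+z. g z \<partial>measure_pmf (jump_pmf q (jump_chain x \<omega> n))) *
      indicator {\<omega>. no_return x \<omega> n} \<omega> \<partial>ctmc_space q)"
  \<comment> \<open>Here \<open>tl\<close> drops the newest state before \<open>butlast\<close>
    drops the initial one, so this factor tests only the first \<open>n\<close> jumps and leaves the
    inner integral.\<close>
  using nn_integral_history_Suc[of
      "\<lambda>l. g (hd l) * of_bool (x \<notin> set (butlast (tl l)))" x n]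
  by (simp add: no_return_iff_history indicator_def nn_integral_multc)

text \<open>By induction the bound fails with probability 0: from a state with
  \<open>g y \<le> g x + n\<close> no single jump leads above \<open>g x + Suc n\<close>.\<close>

lemma jump_chain_Suc_le:
  fixes g :: "'s \<Rightarrow> nat"
  assumes step: "\<And>y z. z \<in> set_pmf (jump_pmf q y) \<Longrightarrow> g z \<le> g y + 1"
  shows "AE \<omega> in ctmc_space q. g (jump_chain x \<omega> n) \<le> g x + n"
proof -
  have "(\<integral>\<^sup>+\<omega>. indicator {y. g x + n < g y} (jump_chain x \<omega> n) \<partial>ctmc_space q) = 0"
  proof (induction n)
    case (Suc n)
    have "(\<integral>\<^sup>+\<omega>. indicator {y. g x + Suc n < g y} (jump_chain x \<omega> (Suc n)) \<partial>ctmc_space q) =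
      (\<integral>\<^sup>+\<omega>. (\<integral>\<^sup>+z. indicator {y. g x + Suc n < g y} z
        \<partial>measure_pmf (jump_pmf q (jump_chain x \<omega> n))) \<partial>ctmc_space q)"
      using nn_integral_history_Suc[of "\<lambda>l. indicator {y. g x + Suc n < g y} (hd l)" x n]
      by simp
    also have "\<dots> \<le> (\<integral>\<^sup>+\<omega>. indicator {y. g x + n < g y} (jump_chain x \<omega> n) \<partial>ctmc_space q)"
    proof (rule nn_integral_mono)
      fix \<omega>
      have "(\<integral>\<^sup>+z. indicator {y. g x + Suc n < g y} z \<partial>measure_pmf (jump_pmf q y)) \<le>
        (\<integral>\<^sup>+z. indicator {y. g x + n < g y} y \<partial>measure_pmf (jump_pmf q y))" for y
        by (intro nn_integral_mono_AE AE_pmfI) (use step in \<open>fastforce simp: indicator_def\<close>)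
      then show "(\<integral>\<^sup>+z. indicator {y. g x + Suc n < g y} z
          \<partial>measure_pmf (jump_pmf q (jump_chain x \<omega> n))) \<le>
        indicator {y. g x + n < g y} (jump_chain x \<omega> n)"
        by (simp add: measure_pmf.emeasure_space_1)
    qed
    finally show ?case
      using Suc by simp
  qed simp
  then have "AE \<omega> in ctmc_space q. indicator {y. g x + n < g y} (jump_chain x \<omega> n) = (0 :: ennreal)"
    by (subst (asm) nn_integral_0_iff_AE) auto
  then show ?thesis
    by eventually_elim (auto simp: indicator_def not_less split: if_splits)
qed

section \<open>Expected return time as a sum of survival probabilities\<close>

text \<open>The sum is the time spent before the first return. A visit at jump \<open>n\<close>
  switches off the terms from \<open>n\<close> on, so the sum is at most \<open>jump_time\<close> at
  every visit, on every sample path.\<close>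

lemma return_time_ge:
  "(\<Sum>n. holding_time q x \<omega> n * indicator {\<omega>. no_return x \<omega> n} \<omega>) \<le> return_time q x \<omega>"
  unfolding return_time_eq_INF
proof (rule INF_greatest)
  fix n :: nat assume "n \<in> {1..}"
  have "(\<Sum>k. holding_time q x \<omega> k * indicator {\<omega>. no_return x \<omega> k} \<omega>) \<le> jump_time q x \<omega> n"
    if "jump_chain x \<omega> n = x"
  proof -
    have "\<not> no_return x \<omega> k" if "n \<le> k" for k
      using that \<open>n \<in> {1..}\<close> \<open>jump_chain x \<omega> n = x\<close> by (auto simp: no_return_def)
    then have "(\<Sum>k. holding_time q x \<omega> k * indicator {\<omega>. no_return x \<omega> k} \<omega>) =
      (\<Sum>k<n. holding_time q x \<omega> k * indicator {\<omega>. no_return x \<omega> k} \<omega>)"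
      by (intro suminf_finite) auto
    also have "\<dots> \<le> jump_time q x \<omega> n"
      unfolding jump_time_def by (intro sum_mono) (auto simp: indicator_def)
    finally show ?thesis .
  qed
  then show "(\<Sum>k. holding_time q x \<omega> k * indicator {\<omega>. no_return x \<omega> k} \<omega>) \<le>
      (if jump_chain x \<omega> n = x \<and> jump_time q x \<omega> n < jump_time q x \<omega> (Suc n)
       then jump_time q x \<omega> n else \<infinity>)"
    by simp
qed

text \<open>With positive clocks the first return, at jump \<open>T\<close>, has positive duration,
  so \<open>jump_time\<close> at \<open>T\<close> takes part in the infimum that gives the return
  time.\<close>

lemma return_time_le:
  assumes pos: "\<And>n. 0 < snd \<omega> n" and return: "\<not> no_return x \<omega> m"
  shows "return_time q x \<omega> \<le> (\<Sum>n. holding_time q x \<omega> n * indicator {\<omega>. no_return x \<omega> n} \<omega>)"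
proof -
  define T where "T = (LEAST n. \<not> no_return x \<omega> n)"
  have T: "\<not> no_return x \<omega> T"
    unfolding T_def using return by (rule LeastI)
  have before: "no_return x \<omega> k" if "k < T" for k
    using that not_less_Least unfolding T_def by blast
  obtain T' where T': "T = Suc T'"
    using T by (cases T) auto
  have XT: "jump_chain x \<omega> T = x"
    using T before[of T'] by (simp add: T' no_return_Suc del: jump_chain.simps)
  have holding: "holding_time q x \<omega> k = ennreal (snd \<omega> k / r)" for k
    using pos[of k] rate_pos by (simp add: holding_time_def divide_ennreal)
  have "jump_time q x \<omega> T = ennreal (\<Sum>k<T. snd \<omega> k / r)"
    unfolding jump_time_def holding
    using pos rate_pos by (intro sum_ennreal) (simp add: less_imp_le)
  then have "jump_time q x \<omega> T < jump_time q x \<omega> (Suc T)"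
    using pos[of T] rate_pos sum_nonneg[of "{..<T}" "\<lambda>k. snd \<omega> k / r"] less_imp_le[OF pos]
    by (simp add: jump_time_def holding ennreal_less_iff flip: ennreal_plus)
  then have "return_time q x \<omega> \<le> jump_time q x \<omega> T"
    unfolding return_time_eq_INF using XT by (intro INF_lower2[of T]) (auto simp: T')
  also have "\<dots> = (\<Sum>k<T. holding_time q x \<omega> k * indicator {\<omega>. no_return x \<omega> k} \<omega>)"
    unfolding jump_time_def using before by (intro sum.cong) (auto simp: indicator_def)
  also have "\<dots> \<le> (\<Sum>n. holding_time q x \<omega> n * indicator {\<omega>. no_return x \<omega> n} \<omega>)"
    by (intro sum_le_suminf) auto
  finally show ?thesis .
qed

text \<open>\<open>no_return\<close> depends on the jump chain alone, so each clock contributes its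
  mean divided by \<open>r\<close>; sum and integral are exchanged by monotone convergence.\<close>

lemma nn_integral_time_before_return:
  "(\<integral>\<^sup>+\<omega>. (\<Sum>n. holding_time q x \<omega> n * indicator {\<omega>. no_return x \<omega> n} \<omega>) \<partial>ctmc_space q) =
   (\<Sum>n. survival x n) / ennreal r"
proof -
  have "(\<integral>\<^sup>+\<omega>. holding_time q x \<omega> n * indicator {\<omega>. no_return x \<omega> n} \<omega> \<partial>ctmc_space q) =
    survival x n * inverse (ennreal r)" for n
  proof -
    have "(\<integral>\<^sup>+\<omega>. holding_time q x \<omega> n * indicator {\<omega>. no_return x \<omega> n} \<omega> \<partial>ctmc_space q) =
      (\<integral>\<^sup>+\<omega>. (ennreal (snd \<omega> n) * indicator {\<omega>. no_return x \<omega> n} \<omega>) * inverse (ennreal r) \<partial>ctmc_space q)"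
      by (auto intro!: nn_integral_cong simp: holding_time_def divide_ennreal_def ac_simps)
    also have "\<dots> = (\<integral>\<^sup>+\<omega>. ennreal (snd \<omega> n) * indicator {\<omega>. no_return x \<omega> n} \<omega> \<partial>ctmc_space q) *
        inverse (ennreal r)"
      by (rule nn_integral_multc) measurable
    also have "(\<integral>\<^sup>+\<omega>. ennreal (snd \<omega> n) * indicator {\<omega>. no_return x \<omega> n} \<omega> \<partial>ctmc_space q) =
        survival x n"
      unfolding survival_def
      by (rule nn_integral_exp_clock_independent) (auto intro!: no_return_cong)
    finally show ?thesis .
  qed
  then show ?thesis
    by (subst nn_integral_suminf) (auto simp: divide_ennreal_def)
qed

text \<open>A Borel-Cantelli argument: the sum is the expected number of \<open>n\<close> without a
  return within \<open>n\<close> jumps, and that number is infinite on a path that never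
  returns.\<close>

lemma AE_return:
  assumes "(\<Sum>n. survival x n) < \<infinity>"
  shows "AE \<omega> in ctmc_space q. \<exists>n. \<not> no_return x \<omega> n"
proof -
  have "(\<integral>\<^sup>+\<omega>. (\<Sum>n. indicator {\<omega>\<in>space (ctmc_space q). no_return x \<omega> n} \<omega>) \<partial>ctmc_space q) =
      (\<Sum>n. survival x n)"
    unfolding survival_def by (subst nn_integral_suminf) auto
  with assms have "AE \<omega> in ctmc_space q.
      (\<Sum>n. indicator {\<omega>\<in>space (ctmc_space q). no_return x \<omega> n} \<omega>) \<noteq> (\<infinity> :: ennreal)"
    by (intro nn_integral_PInf_AE) auto
  with AE_space show ?thesis
  proof eventually_elim
    case (elim \<omega>)
    show ?case
    proof (rule ccontr)
      assume "\<nexists>n. \<not> no_return x \<omega> n"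
      then have "(\<Sum>n. indicator {\<omega>\<in>space (ctmc_space q). no_return x \<omega> n} \<omega>) =
          (\<Sum>n. 1 :: ennreal)"
        using elim by (intro suminf_cong) auto
      moreover have "(\<Sum>n. 1 :: ennreal) = \<infinity>"
        using nn_integral_count_space_nat[of "\<lambda>_. 1"] by simp
      ultimately show False
        using elim by simp
    qed
  qed
qed

text \<open>The return time is compared with the time before the first return in both directions; a
  finite sum forces a return almost surely, as the upper bound requires. Since \<open>r\<close> is
  positive, no state is absorbing.\<close>

lemma positive_recurrent_state_iff:
  "positive_recurrent_state q x \<longleftrightarrow> (\<Sum>n. survival x n) < \<infinity>"
proof -
  let ?S = "\<lambda>\<omega>. \<Sum>n. holding_time q x \<omega> n * indicator {\<omega>. no_return x \<omega> n} \<omega>"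
  have finite_iff: "(\<integral>\<^sup>+\<omega>. ?S \<omega> \<partial>ctmc_space q) < \<infinity> \<longleftrightarrow> (\<Sum>n. survival x n) < \<infinity>"
    unfolding nn_integral_time_before_return using rate_pos
    by (auto simp: divide_ennreal_def ennreal_mult_less_top inverse_ennreal)
  have "(\<integral>\<^sup>+\<omega>. return_time q x \<omega> \<partial>ctmc_space q) < \<infinity> \<longleftrightarrow> (\<Sum>n. survival x n) < \<infinity>"
  proof
    assume "(\<integral>\<^sup>+\<omega>. return_time q x \<omega> \<partial>ctmc_space q) < \<infinity>"
    moreover have "(\<integral>\<^sup>+\<omega>. ?S \<omega> \<partial>ctmc_space q) \<le> (\<integral>\<^sup>+\<omega>. return_time q x \<omega> \<partial>ctmc_space q)"
      by (intro nn_integral_mono return_time_ge)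
    ultimately show "(\<Sum>n. survival x n) < \<infinity>"
      using finite_iff by (meson le_less_trans)
  next
    assume finite: "(\<Sum>n. survival x n) < \<infinity>"
    have "AE \<omega> in ctmc_space q. return_time q x \<omega> \<le> ?S \<omega>"
      using AE_exp_clock_pos AE_return[OF finite]
      by eventually_elim (auto intro: return_time_le)
    then have "(\<integral>\<^sup>+\<omega>. return_time q x \<omega> \<partial>ctmc_space q) \<le> (\<integral>\<^sup>+\<omega>. ?S \<omega> \<partial>ctmc_space q)"
      by (rule nn_integral_mono_AE)
    then show "(\<integral>\<^sup>+\<omega>. return_time q x \<omega> \<partial>ctmc_space q) < \<infinity>"
      using finite finite_iff by (meson le_less_trans)
  qed
  then show ?thesis
    using rate_pos by (simp add: positive_recurrent_state_def)
qed

section \<open>Drift criteria for and against positive recurrence\<close>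

lemma survival_0: "survival x 0 = 1"
  unfolding survival_def using prob_space.emeasure_space_1[OF prob_space_ctmc_space] by simp

lemma nn_integral_no_return:
  "(\<integral>\<^sup>+\<omega>. indicator {\<omega>. no_return x \<omega> n} \<omega> \<partial>ctmc_space q) = survival x n"
  unfolding survival_def
  by (simp flip: nn_integral_indicator) (auto intro!: nn_integral_cong simp: indicator_def)

lemma measurable_function_jump_chain [measurable]:
  "(\<lambda>\<omega>. g (jump_chain x \<omega> n)) \<in> borel_measurable (ctmc_space q)"
  by (rule measurable_compose[OF measurable_jump_chain]) simp

text \<open>Away from \<open>x\<close> each jump lowers the mean of \<open>V\<close> by at least the
  current survival probability. As \<open>V\<close> is nonnegative, these losses add up to at most
  the mean of \<open>V\<close> after the first jump.\<close>

lemma foster_positive_recurrent_state: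
  fixes V :: "'s \<Rightarrow> ennreal"
  assumes drift: "\<And>y. y \<noteq> x \<Longrightarrow> (\<integral>\<^sup>+z. V z \<partial>measure_pmf (jump_pmf q y)) + 1 \<le> V y"
    and finite: "(\<integral>\<^sup>+z. V z \<partial>measure_pmf (jump_pmf q x)) < \<infinity>"
  shows "positive_recurrent_state q x"
proof -
  define v where
    "v n = (\<integral>\<^sup>+\<omega>. V (jump_chain x \<omega> n) * indicator {\<omega>. no_return x \<omega> n} \<omega> \<partial>ctmc_space q)" for n
  \<comment> \<open>\<open>w n\<close> is the mean after jump \<open>n + 1\<close> before the paths
    that return at that very jump are discarded; discarding them gives
    \<open>v (Suc n)\<close>.\<close>
  define w where
    "w n = (\<integral>\<^sup>+\<omega>. V (jump_chain x \<omega> (Suc n)) * indicator {\<omega>. no_return x \<omega> n} \<omega> \<partial>ctmc_space q)" for n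
  have v_le_w: "v (Suc n) \<le> w n" for n
    unfolding v_def w_def
    by (intro nn_integral_mono mult_left_mono) (auto simp: indicator_def no_return_Suc)
  have w0: "w 0 = (\<integral>\<^sup>+z. V z \<partial>measure_pmf (jump_pmf q x))"
    using prob_space.emeasure_space_1[OF prob_space_ctmc_space, of q]
    unfolding w_def nn_integral_jump_chain_Suc by simp
  have step: "w n + survival x n \<le> v n" if "0 < n" for n
  proof -
    have "w n + survival x n = (\<integral>\<^sup>+\<omega>. ((\<integral>\<^sup>+z. V z \<partial>measure_pmf (jump_pmf q (jump_chain x \<omega> n))) + 1) *
        indicator {\<omega>. no_return x \<omega> n} \<omega> \<partial>ctmc_space q)"
      unfolding w_def nn_integral_jump_chain_Suc
      by (simp add: distrib_right nn_integral_add nn_integral_no_return)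
    also have "\<dots> \<le> v n"
      unfolding v_def
    proof (rule nn_integral_mono)
      fix \<omega>
      show "((\<integral>\<^sup>+z. V z \<partial>measure_pmf (jump_pmf q (jump_chain x \<omega> n))) + 1) *
          indicator {\<omega>. no_return x \<omega> n} \<omega> \<le>
        V (jump_chain x \<omega> n) * indicator {\<omega>. no_return x \<omega> n} \<omega>"
        using drift no_return_jump_chain[OF _ that, of x \<omega>] by (cases "no_return x \<omega> n") auto
    qed
    finally show ?thesis .
  qed
  \<comment> \<open>The summand 1 is \<open>survival x 0\<close>: at time 0 the chain is in
    \<open>x\<close>, where no drift is assumed.\<close>
  have bound: "v (Suc n) + (\<Sum>k<Suc n. survival x k) \<le> 1 + w 0" for n
  proof (induction n)
    case 0
    then show ?case
      using v_le_w[of 0] by (simp add: survival_0 add.commute add_left_mono)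
  next
    case (Suc n)
    have "v (Suc (Suc n)) + (\<Sum>k<Suc (Suc n). survival x k) \<le>
        (w (Suc n) + survival x (Suc n)) + (\<Sum>k<Suc n. survival x k)"
      using add_right_mono[OF v_le_w[of "Suc n"], of "\<Sum>k<Suc (Suc n). survival x k"]
      by (simp add: ac_simps)
    also have "\<dots> \<le> v (Suc n) + (\<Sum>k<Suc n. survival x k)"
      by (intro add_right_mono step) simp
    also note Suc
    finally show ?case .
  qed
  have "(\<Sum>k<n. survival x k) \<le> v (Suc n) + (\<Sum>k<Suc n. survival x k)" for n
    by (simp add: add_increasing)
  then have "(\<Sum>k<n. survival x k) \<le> 1 + w 0" for n
    using bound by (rule order_trans)
  then have "(\<Sum>n. survival x n) \<le> 1 + w 0"
    by (intro suminf_le_const) auto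
  also have "\<dots> < \<infinity>"
    using finite by (simp add: w0)
  finally show ?thesis
    by (simp add: positive_recurrent_state_iff)
qed

text \<open>The mean of \<open>g\<close> over paths without return never decreases, while
  \<open>g\<close> is at most \<open>n\<close> after \<open>n\<close> jumps. So survival decays no
  faster than a constant over \<open>n\<close>.\<close>

lemma not_positive_recurrent_state_of_submartingale:
  fixes g :: "'s \<Rightarrow> nat"
  assumes zero: "g x = 0"
    and submartingale: "\<And>y. of_nat (g y) \<le> (\<integral>\<^sup>+z. of_nat (g z) \<partial>measure_pmf (jump_pmf q y))"
    and step: "\<And>y z. z \<in> set_pmf (jump_pmf q y) \<Longrightarrow> g z \<le> g y + 1"
    and start: "0 < (\<integral>\<^sup>+z. of_nat (g z) \<partial>measure_pmf (jump_pmf q x))"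
  shows "\<not> positive_recurrent_state q x"
proof -
  define m :: "nat \<Rightarrow> ennreal" where
    "m n = (\<integral>\<^sup>+\<omega>. of_nat (g (jump_chain x \<omega> n)) * indicator {\<omega>. no_return x \<omega> n} \<omega> \<partial>ctmc_space q)" for n
  let ?e = "\<integral>\<^sup>+z. of_nat (g z) \<partial>measure_pmf (jump_pmf q x)"
  \<comment> \<open>Paths returning at jump \<open>Suc n\<close> end in \<open>x\<close>, where
    \<open>g\<close> is 0, so the indicator for \<open>n\<close> may replace that for
    \<open>Suc n\<close>.\<close>
  have m_Suc: "m (Suc n) = (\<integral>\<^sup>+\<omega>. (\<integral>\<^sup>+z. of_nat (g z) \<partial>measure_pmf (jump_pmf q (jump_chain x \<omega> n))) *
      indicator {\<omega>. no_return x \<omega> n} \<omega> \<partial>ctmc_space q)" for n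
    unfolding m_def nn_integral_jump_chain_Suc[symmetric]
    by (intro nn_integral_cong) (auto simp: indicator_def no_return_Suc zero simp del: jump_chain.simps)
  have e_le_m: "?e \<le> m (Suc n)" for n
  proof (induction n)
    case 0
    show ?case
      using prob_space.emeasure_space_1[OF prob_space_ctmc_space, of q] by (simp add: m_Suc)
  next
    case (Suc n)
    also have "m (Suc n) \<le> m (Suc (Suc n))"
      unfolding m_Suc[of "Suc n"] m_def[of "Suc n"]
      by (intro nn_integral_mono mult_right_mono submartingale) simp
    finally show ?case .
  qed
  have m_le: "m n \<le> of_nat n * survival x n" for n
  proof -
    have "AE \<omega> in ctmc_space q. g (jump_chain x \<omega> n) \<le> n"
      using jump_chain_Suc_le[of g x n] step by (simp add: zero)
    then have "m n \<le> (\<integral>\<^sup>+\<omega>. of_nat n * indicator {\<omega>. no_return x \<omega> n} \<omega> \<partial>ctmc_space q)"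
      unfolding m_def by (intro nn_integral_mono_AE) (auto elim!: eventually_mono intro!: mult_right_mono)
    then show ?thesis
      by (simp add: nn_integral_cmult nn_integral_no_return)
  qed
  define s where "s n = measure (ctmc_space q) {\<omega>\<in>space (ctmc_space q). no_return x \<omega> n}" for n
  have s_nonneg: "0 \<le> s n" and survival_eq: "survival x n = ennreal (s n)" for n
    using prob_space.finite_measure[OF prob_space_ctmc_space, of q]
    by (simp_all add: s_def survival_def finite_measure.emeasure_eq_measure)
  have e_le: "?e \<le> of_nat (Suc n) * survival x (Suc n)" for n
    using e_le_m m_le by (rule order_trans)
  have le: "enn2real ?e \<le> of_nat (Suc n) * s (Suc n)" for n
  proof (rule enn2real_leI)
    show "?e \<le> ennreal (of_nat (Suc n) * s (Suc n))"
      using e_le[of n] ennreal_mult'[of "of_nat (Suc n)" "s (Suc n)"]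
      unfolding survival_eq ennreal_of_nat_eq_real_of_nat by simp
  qed (simp add: s_nonneg)
  \<comment> \<open>The bound for a single jump also shows that \<open>?e\<close> is finite, so its
    real value is positive too.\<close>
  have e_pos: "0 < enn2real ?e"
    using start e_le[of 0]
    by (auto simp: enn2real_positive_iff survival_eq intro: le_less_trans)
  show ?thesis
  proof
    assume "positive_recurrent_state q x"
    then have "(\<Sum>n. ennreal (s n)) \<noteq> top"
      by (simp add: positive_recurrent_state_iff survival_eq less_top)
    then have "summable s"
      using s_nonneg by (intro summable_suminf_not_top)
    then have "summable (\<lambda>n. s (Suc n) / enn2real ?e)"
      by (intro summable_divide) (simp add: summable_Suc_iff)
    moreover have "norm (inverse (real (Suc n))) \<le> s (Suc n) / enn2real ?e" for n
      using le[of n] e_pos by (simp add: field_simps)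
    ultimately have "summable (\<lambda>n. inverse (real (Suc n)))"
      by (rule summable_comparison_test'[where N = 0])
    then show False
      using not_summable_harmonic[where 'a = real] summable_Suc_iff[of "\<lambda>n. inverse (real n)"]
      by blast
  qed
qed

end

section \<open>Recurrence of the matchmaking chain\<close>

text \<open>A finite superset of the possible targets, of the same shape for every integer; the rate
  to \<open>Choice_Free\<close> is 0 unless \<open>i = 0\<close>.\<close>

fun queue_neighbours :: "queue_state \<Rightarrow> queue_state set" where
  "queue_neighbours (Waiting i) = {Waiting (i + 1), Waiting (i - 1), Choice_Free}"
| "queue_neighbours Choice_Free = {Waiting 0}"

lemma finite_queue_neighbours [simp]: "finite (queue_neighbours x)"
  by (cases x) auto

lemma queue_rate_eq_0: "y \<notin> queue_neighbours x \<Longrightarrow> queue_rate a b c x y = 0"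
  by (cases x; cases y) auto

lemma not_queue_neighbour_self: "x \<notin> queue_neighbours x"
  by (cases x) auto

lemma sum_queue_neighbours:
  fixes f :: "queue_state \<Rightarrow> 'a::comm_monoid_add"
  shows "(\<Sum>y\<in>queue_neighbours (Waiting i). f y) = f (Waiting (i + 1)) + (f (Waiting (i - 1)) + f Choice_Free)"
  and "(\<Sum>y\<in>queue_neighbours Choice_Free. f y) = f (Waiting 0)"
  by auto

text \<open>In every state each arriving player causes exactly one jump, so the exit rate is the
  total arrival rate.\<close>

lemma queue_rate_has_sum:
  "(queue_rate a b c x has_sum (a + b + c)) (- {x})"
proof -
  have "(queue_rate a b c x has_sum (\<Sum>y\<in>queue_neighbours x. queue_rate a b c x y)) (queue_neighbours x)"
    by (intro has_sum_finite) simp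
  also have "(\<Sum>y\<in>queue_neighbours x. queue_rate a b c x y) = a + b + c"
    by (cases x) (simp_all only: sum_queue_neighbours, auto)
  finally show ?thesis
    by (rule has_sum_cong_neutral[THEN iffD1, rotated 3])
      (use not_queue_neighbour_self in \<open>auto simp: queue_rate_eq_0\<close>)
qed

locale matchmaking =
  fixes a b c :: real
  assumes a_pos: "a > 0" and b_pos: "b > 0" and c_pos: "c > 0"
begin

sublocale uniform_rate_chain "queue_rate a b c" "a + b + c"
  using a_pos b_pos c_pos queue_rate_has_sum
  by unfold_locales (auto simp: exit_rate_def intro!: infsumI)

lemma queue_rate_nonneg: "0 \<le> queue_rate a b c x y"
  using a_pos b_pos c_pos by (cases x; cases y) auto

lemma pmf_queue_jump:
  "pmf (jump_pmf (queue_rate a b c) x) y = queue_rate a b c x y / (a + b + c)"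
proof -
  have "queue_rate a b c x summable_on - {x}"
    using queue_rate_has_sum by (rule has_sum_imp_summable)
  then show ?thesis
    using rate_pos queue_rate_nonneg queue_rate_eq_0[OF not_queue_neighbour_self]
    by (subst pmf_jump_pmf) auto
qed

lemma set_pmf_queue_jump: "set_pmf (jump_pmf (queue_rate a b c) x) \<subseteq> queue_neighbours x"
  using queue_rate_eq_0 by (fastforce simp: set_pmf_iff pmf_queue_jump)

text \<open>Finitely many targets make the one-step mean a finite real sum, so drift conditions
  become real inequalities.\<close>

lemma nn_integral_queue_jump:
  assumes "\<And>y. 0 \<le> f y"
  shows "(\<integral>\<^sup>+y. ennreal (f y) \<partial>measure_pmf (jump_pmf (queue_rate a b c) x)) =
    ennreal ((\<Sum>y\<in>queue_neighbours x. queue_rate a b c x y * f y) / (a + b + c))"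
proof -
  have "(\<integral>\<^sup>+y. ennreal (f y) \<partial>measure_pmf (jump_pmf (queue_rate a b c) x)) =
    (\<Sum>y\<in>queue_neighbours x. ennreal (f y) * ennreal (queue_rate a b c x y / (a + b + c)))"
    using set_pmf_queue_jump
    by (subst nn_integral_measure_pmf_support[where A = "queue_neighbours x"])
      (auto simp: pmf_queue_jump)
  also have "\<dots> = (\<Sum>y\<in>queue_neighbours x. ennreal (f y * (queue_rate a b c x y / (a + b + c))))"
    using assms by (intro sum.cong refl ennreal_mult'[symmetric])
  also have "\<dots> = ennreal (\<Sum>y\<in>queue_neighbours x. f y * (queue_rate a b c x y / (a + b + c)))"
    using assms queue_rate_nonneg rate_pos by (intro sum_ennreal) (simp add: less_imp_le)
  also have "(\<Sum>y\<in>queue_neighbours x. f y * (queue_rate a b c x y / (a + b + c))) =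
      (\<Sum>y\<in>queue_neighbours x. queue_rate a b c x y * f y) / (a + b + c)"
    by (simp add: sum_divide_distrib mult.commute)
  finally show ?thesis .
qed

text \<open>The Foster criterion multiplied by the exit rate; the mean after a jump from
  \<open>x\<close> is finite because there are finitely many targets.\<close>

lemma positive_recurrent_state_lyapunov:
  fixes V :: "queue_state \<Rightarrow> real"
  assumes nonneg: "\<And>y. 0 \<le> V y"
    and drift: "\<And>y. y \<noteq> x \<Longrightarrow>
      (\<Sum>z\<in>queue_neighbours y. queue_rate a b c y z * V z) \<le> (a + b + c) * (V y - 1)"
  shows "positive_recurrent_state (queue_rate a b c) x"
proof (rule foster_positive_recurrent_state)
  fix y assume "y \<noteq> x"
  from drift[OF this] rate_pos
  have "(\<Sum>z\<in>queue_neighbours y. queue_rate a b c y z * V z) / (a + b + c) + 1 \<le> V y"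
    by (simp add: field_simps)
  moreover have "0 \<le> (\<Sum>z\<in>queue_neighbours y. queue_rate a b c y z * V z) / (a + b + c)"
    using rate_pos by (intro divide_nonneg_pos sum_nonneg mult_nonneg_nonneg queue_rate_nonneg nonneg)
  ultimately show "(\<integral>\<^sup>+z. ennreal (V z) \<partial>measure_pmf (jump_pmf (queue_rate a b c) y)) + 1 \<le> ennreal (V y)"
    unfolding nn_integral_queue_jump[OF nonneg]
    by (simp add: ennreal_leI flip: ennreal_1 ennreal_plus)
qed (simp add: nn_integral_queue_jump nonneg)

lemma not_positive_recurrent_of_submartingale:
  fixes g :: "queue_state \<Rightarrow> nat"
  assumes zero: "g (Waiting 0) = 0"
    and submartingale: "\<And>y. (a + b + c) * real (g y) \<le>
      (\<Sum>z\<in>queue_neighbours y. queue_rate a b c y z * real (g z))"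
    and step: "\<And>y z. z \<in> queue_neighbours y \<Longrightarrow> g z \<le> g y + 1"
    and start: "0 < (\<Sum>z\<in>queue_neighbours (Waiting 0). queue_rate a b c (Waiting 0) z * real (g z))"
  shows "\<not> positive_recurrent (queue_rate a b c)"
proof -
  have int: "(\<integral>\<^sup>+z. of_nat (g z) \<partial>measure_pmf (jump_pmf (queue_rate a b c) y)) =
    ennreal ((\<Sum>z\<in>queue_neighbours y. queue_rate a b c y z * real (g z)) / (a + b + c))" for y
    using nn_integral_queue_jump[of "\<lambda>y. real (g y)" y] by (simp add: ennreal_of_nat_eq_real_of_nat)
  have "\<not> positive_recurrent_state (queue_rate a b c) (Waiting 0)"
  proof (rule not_positive_recurrent_state_of_submartingale[of g])
    show "of_nat (g y) \<le> (\<integral>\<^sup>+z. of_nat (g z) \<partial>measure_pmf (jump_pmf (queue_rate a b c) y))" for y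
      unfolding int unfolding ennreal_of_nat_eq_real_of_nat
      using submartingale[of y] rate_pos by (intro ennreal_leI) (simp add: field_simps)
    show "0 < (\<integral>\<^sup>+z. of_nat (g z) \<partial>measure_pmf (jump_pmf (queue_rate a b c) (Waiting 0)))"
      unfolding int using start rate_pos by simp
  qed (use zero step set_pmf_queue_jump in auto)
  then show ?thesis
    by (auto simp: positive_recurrent_def)
qed

section \<open>Necessity of the rate condition\<close>

lemma positive_recurrent_imp_less:
  assumes "positive_recurrent (queue_rate a b c)"
  shows "\<bar>a - b\<bar> < c"
proof (rule ccontr)
  assume "\<not> \<bar>a - b\<bar> < c"
  then consider "b + c \<le> a" | "a + c \<le> b"
    by linarith
  then show False
  proof cases
    case 1
    \<comment> \<open>The positive part of the state has drift \<open>a - b - c\<close>, here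
      nonnegative, on the positive side, drift \<open>a\<close> at the empty queue, and drift 0
      elsewhere.\<close>
    define g where "g y = (case y of Waiting i \<Rightarrow> nat i | Choice_Free \<Rightarrow> 0)" for y
    have g_simps: "g (Waiting i) = nat i" "g Choice_Free = 0" for i
      by (simp_all add: g_def)
    have "\<not> positive_recurrent (queue_rate a b c)"
    proof (rule not_positive_recurrent_of_submartingale[of g])
      show "(a + b + c) * real (g y) \<le> (\<Sum>z\<in>queue_neighbours y. queue_rate a b c y z * real (g z))" for y
      proof (cases y)
        case (Waiting i)
        consider "i < 0" | "i = 0" | "0 < i"
          by linarith
        then show ?thesis
          by cases (use 1 a_pos b_pos c_pos in \<open>simp_all only: Waiting sum_queue_neighbours g_simps, auto simp: algebra_simps\<close>)
      qed (simp add: g_simps)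
      show "g z \<le> g y + 1" if "z \<in> queue_neighbours y" for y z
        using that by (cases y) (auto simp: g_simps)
    qed (use a_pos in \<open>auto simp: g_simps sum_queue_neighbours\<close>)
    with assms show False
      by simp
  next
    case 2
    \<comment> \<open>The mirror image: the number of waiting side-B players, with drift
      \<open>b - a - c\<close> on the negative side.\<close>
    define g where "g y = (case y of Waiting i \<Rightarrow> nat (- i) | Choice_Free \<Rightarrow> 0)" for y
    have g_simps: "g (Waiting i) = nat (- i)" "g Choice_Free = 0" for i
      by (simp_all add: g_def)
    have "\<not> positive_recurrent (queue_rate a b c)"
    proof (rule not_positive_recurrent_of_submartingale[of g])
      show "(a + b + c) * real (g y) \<le> (\<Sum>z\<in>queue_neighbours y. queue_rate a b c y z * real (g z))" for y
      proof (cases y)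
        case (Waiting i)
        consider "i < 0" | "i = 0" | "0 < i"
          by linarith
        then show ?thesis
          by cases (use 2 a_pos b_pos c_pos in \<open>simp_all only: Waiting sum_queue_neighbours g_simps, auto simp: algebra_simps\<close>)
      qed (simp add: g_simps)
      show "g z \<le> g y + 1" if "z \<in> queue_neighbours y" for y z
        using that by (cases y) (auto simp: g_simps)
    qed (use b_pos in \<open>auto simp: g_simps sum_queue_neighbours\<close>)
    with assms show False
      by simp
  qed
qed

end

section \<open>Lyapunov functions and sufficiency of the rate condition\<close>

text \<open>
  The increment of the potential from \<open>i - 1\<close> to \<open>i\<close> is \<open>H\<close> for \<open>i > 0\<close>
  and \<open>H * R ^ (1 - i)\<close> for \<open>i \<le> 0\<close>.  It has drift at most \<open>- 1\<close> everywhere, so that it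
  serves every target state to the left of the current one.
\<close>

definition potential :: "real \<Rightarrow> real \<Rightarrow> int \<Rightarrow> real" where
  "potential H R i = (if 0 \<le> i then H * i else - (H * (\<Sum>k<nat (- i). R ^ Suc k)))"

lemma potential_pred:
  shows "0 < i \<Longrightarrow> potential H R (i - 1) = potential H R i - H"
    and "i \<le> 0 \<Longrightarrow> potential H R (i - 1) = potential H R i - H * R ^ Suc (nat (- i))"
proof -
  assume "i \<le> 0"
  then have "nat (- (i - 1)) = Suc (nat (- i))"
    by simp
  then show "potential H R (i - 1) = potential H R i - H * R ^ Suc (nat (- i))"
    using \<open>i \<le> 0\<close> by (auto simp: potential_def algebra_simps)
qed (simp add: potential_def algebra_simps)

lemma potential_mono:
  assumes "0 \<le> H" "0 \<le> R" "i \<le> j"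
  shows "potential H R i \<le> potential H R j"
  using \<open>i \<le> j\<close>
proof (induction i rule: int_le_induct)
  case (step i)
  moreover have "potential H R (i - 1) \<le> potential H R i"
    using assms potential_pred[of i H R] by (cases "0 < i") auto
  ultimately show ?case
    by simp
qed simp

text \<open>For \<open>i > 0\<close> the downward drift \<open>b + c - a\<close> is scaled up by
  \<open>H\<close>. For \<open>i \<le> 0\<close> the step down is \<open>R\<close> times the step
  up, which outweighs even the upward rate \<open>a + c\<close>. The last summand is the jump to
  \<open>Choice_Free\<close>, valued one above the empty queue.\<close>

lemma potential_drift:
  assumes pos: "a > 0" "b > 0" "c > 0" and H: "1 \<le> H" "a + b + c \<le> (b + c - a) * H"
    and R: "1 \<le> R" "a + c + (a + b + c) \<le> b * R"
  shows "(if i \<ge> 0 then a else a + c) * potential H R (i + 1) +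
    (if i \<le> 0 then b else b + c) * potential H R (i - 1) +
    (if i = 0 then c * (potential H R 0 + 1) else 0) \<le> (a + b + c) * (potential H R i - 1)"
proof -
  consider "i < 0" | "i = 0" | "0 < i"
    by linarith
  then show ?thesis
  proof cases
    case 1
    \<comment> \<open>The increment from \<open>i\<close> to \<open>i + 1\<close>; the one from
      \<open>i - 1\<close> to \<open>i\<close> is \<open>R * t\<close>.\<close>
    define t where "t = H * R ^ nat (- i)"
    have t: "1 \<le> t"
      unfolding t_def using mult_mono[of 1 H 1 "R ^ nat (- i)"] H R by simp
    have "nat (- i) = Suc (nat (- (i + 1)))"
      using 1 by simp
    then have up: "potential H R (i + 1) = potential H R i + t"
      using potential_pred(2)[of "i + 1" H R] 1 by (simp add: t_def)
    have down: "potential H R (i - 1) = potential H R i - R * t"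
      using potential_pred(2)[of i H R] 1 by (simp add: t_def mult_ac)
    have "(a + c) * t + (a + b + c) \<le> (a + c) * t + (a + b + c) * t"
      using t pos by simp
    also have "\<dots> \<le> b * R * t"
      using mult_right_mono[OF R(2), of t] t by (simp add: algebra_simps)
    finally show ?thesis
      using 1 unfolding up down by (simp add: algebra_simps)
  next
    case 2
    have "a * H + c + (a + b + c) \<le> a * H + c * H + (a + b + c) * H"
      using pos H(1) by (intro add_mono) auto
    also have "\<dots> \<le> b * R * H"
      using mult_right_mono[OF R(2), of H] H by (simp add: algebra_simps)
    finally have "a * H + c + (a + b + c) \<le> b * R * H" .
    moreover have "potential H R 0 = 0" "potential H R 1 = H" "potential H R (- 1) = - (H * R)"
      by (simp_all add: potential_def)
    ultimately show ?thesis
      using 2 by (simp add: algebra_simps)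
  next
    case 3
    have "potential H R (i + 1) = potential H R i + H"
      using potential_pred(1)[of "i + 1" H R] 3 by simp
    then show ?thesis
      using 3 H by (simp add: potential_pred algebra_simps)
  qed
qed

text \<open>Every requirement is a lower bound on \<open>H\<close> or \<open>R\<close>, since
  \<open>less\<close> makes the coefficients of \<open>H\<close> positive. Swapping \<open>a\<close>
  and \<open>b\<close> permutes the requirements, so the same parameters serve the reflected
  chain.\<close>

lemma ex_potential_parameters:
  fixes a b c :: real
  assumes pos: "a > 0" "b > 0" "c > 0" and less: "\<bar>a - b\<bar> < c"
  obtains H R where "1 \<le> H" "a + b + c \<le> (b + c - a) * H" "a + b + c \<le> (a + c - b) * H"
    "1 \<le> R" "a + c + (a + b + c) \<le> b * R" "b + c + (a + b + c) \<le> a * R"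
proof -
  define H where "H = max 1 (max ((a + b + c) / (b + c - a)) ((a + b + c) / (a + c - b)))"
  define R where "R = max 1 (max ((a + c + (a + b + c)) / b) ((b + c + (a + b + c)) / a))"
  have "0 < b + c - a" "0 < a + c - b"
    using less by auto
  moreover have "(a + b + c) / (b + c - a) \<le> H" "(a + b + c) / (a + c - b) \<le> H"
    by (auto simp: H_def)
  ultimately have "a + b + c \<le> (b + c - a) * H" "a + b + c \<le> (a + c - b) * H"
    by (simp_all add: pos_divide_le_eq mult.commute)
  moreover have "(a + c + (a + b + c)) / b \<le> R" "(b + c + (a + b + c)) / a \<le> R"
    by (auto simp: R_def)
  then have "a + c + (a + b + c) \<le> b * R" "b + c + (a + b + c) \<le> a * R"
    using pos by (simp_all only: pos_divide_le_eq mult.commute)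
  moreover have "1 \<le> H" "1 \<le> R"
    by (simp_all add: H_def R_def)
  ultimately show thesis
    using that by blast
qed

context matchmaking
begin

text \<open>For a target \<open>Waiting m\<close> the potential to the right of \<open>m\<close> is
  glued to a reflected one on the left. For \<open>Choice_Free\<close> the absolute value works, as
  both half-lines drift towards 0.\<close>

lemma less_imp_positive_recurrent:
  assumes "\<bar>a - b\<bar> < c"
  shows "positive_recurrent (queue_rate a b c)"
  unfolding positive_recurrent_def
proof
  fix x
  obtain H R where H: "1 \<le> H" "a + b + c \<le> (b + c - a) * H" "a + b + c \<le> (a + c - b) * H"
    and R: "1 \<le> R" "a + c + (a + b + c) \<le> b * R" "b + c + (a + b + c) \<le> a * R"
    using ex_potential_parameters[OF a_pos b_pos c_pos assms] .
  let ?p = "potential H R"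
  have drift_A: "(if i \<ge> 0 then a else a + c) * ?p (i + 1) + (if i \<le> 0 then b else b + c) * ?p (i - 1) +
    (if i = 0 then c * (?p 0 + 1) else 0) \<le> (a + b + c) * (?p i - 1)" for i
    by (intro potential_drift a_pos b_pos c_pos H R)
  \<comment> \<open>Reflecting \<open>i\<close> to \<open>- i\<close> exchanges the roles of
    \<open>a\<close> and \<open>b\<close>.\<close>
  have drift_B: "(if - i \<ge> 0 then b else b + c) * ?p (- i + 1) + (if - i \<le> 0 then a else a + c) * ?p (- i - 1) +
    (if - i = 0 then c * (?p 0 + 1) else 0) \<le> (b + a + c) * (?p (- i) - 1)" for i
    using H R by (intro potential_drift a_pos b_pos c_pos) simp_all
  have mono: "?p i \<le> ?p j" if "i \<le> j" for i j
    using that H R by (intro potential_mono) auto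
  show "positive_recurrent_state (queue_rate a b c) x"
  proof (cases x)
    case (Waiting m)
    \<comment> \<open>Both branches vanish at \<open>m\<close>, so either formula holds there when
      \<open>m\<close> is a neighbour of \<open>i\<close>. Subtracting a constant preserves the
      drift inequality, since all exit rates are \<open>a + b + c\<close>.\<close>
    define v where "v i = (if m \<le> i then ?p i - ?p m else ?p (- i) - ?p (- m))" for i
    \<comment> \<open>The only jump from \<open>Choice_Free\<close> leads to the empty queue, so the
      value \<open>v 0 + 1\<close> gives it drift exactly \<open>- 1\<close>.\<close>
    define V where "V y = (case y of Waiting i \<Rightarrow> v i | Choice_Free \<Rightarrow> v 0 + 1)" for y
    have V_simps: "V (Waiting i) = v i" "V Choice_Free = v 0 + 1" for i
      by (simp_all add: V_def)
    have v_nonneg: "0 \<le> v i" for i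
      using mono by (simp add: v_def)
    have v_drift: "(if i \<ge> 0 then a else a + c) * v (i + 1) + ((if i \<le> 0 then b else b + c) * v (i - 1) +
      (if i = 0 then c * (v 0 + 1) else 0)) \<le> (a + b + c) * (v i - 1)" if "i \<noteq> m" for i
    proof (cases "m < i")
      case True
      then show ?thesis
        using drift_A[of i] by (auto simp: v_def algebra_simps)
    next
      case False
      with that have "i < m" by simp
      then have v_eqs: "v (i + 1) = ?p (- i - 1) - ?p (- m)" "v (i - 1) = ?p (- i + 1) - ?p (- m)"
        "v i = ?p (- i) - ?p (- m)"
        by (cases "m = i + 1"; auto simp: v_def)+
      show ?thesis
      proof (cases "i = 0")
        case True
        show ?thesis
          unfolding True unfolding v_eqs[unfolded True]
          using drift_B[of 0] by (simp add: algebra_simps)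
      next
        case False
        then show ?thesis
          unfolding v_eqs using drift_B[of i] by (auto simp: algebra_simps)
      qed
    qed
    show ?thesis
    proof (rule positive_recurrent_state_lyapunov[of V])
      show "0 \<le> V y" for y
        using v_nonneg by (cases y) (simp_all add: V_simps add_nonneg_nonneg)
      show "(\<Sum>z\<in>queue_neighbours y. queue_rate a b c y z * V z) \<le> (a + b + c) * (V y - 1)" if "y \<noteq> x" for y
      proof (cases y)
        case (Waiting i)
        then show ?thesis
          using v_drift[of i] that \<open>x = Waiting m\<close> by (auto simp: sum_queue_neighbours V_simps)
      qed (simp add: V_simps)
    qed
  next
    case Choice_Free
    \<comment> \<open>At the empty queue the drop \<open>K\<close> at rate \<open>c\<close> must pay
      for the rise \<open>H\<close> at rate \<open>a + b\<close> and leave drift \<open>- 1\<close>.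
      At other integers \<open>K\<close> cancels.\<close>
    define K where "K = ((a + b) * H + (a + b + c)) / c"
    have K: "c * K = (a + b) * H + (a + b + c)"
      using c_pos by (simp add: K_def)
    have K_nonneg: "0 \<le> K"
      using a_pos b_pos c_pos H by (simp add: K_def)
    define V where "V y = (case y of Waiting i \<Rightarrow> K + H * \<bar>i\<bar> | Choice_Free \<Rightarrow> 0)" for y
    have V_simps: "V (Waiting i) = K + H * \<bar>i\<bar>" "V Choice_Free = 0" for i
      by (simp_all add: V_def)
    show ?thesis
    proof (rule positive_recurrent_state_lyapunov[of V])
      show "0 \<le> V y" for y
        using K_nonneg H by (cases y) (simp_all add: V_simps)
      show "(\<Sum>z\<in>queue_neighbours y. queue_rate a b c y z * V z) \<le> (a + b + c) * (V y - 1)" if "y \<noteq> x" for y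
      proof (cases y)
        case (Waiting i)
        consider "i < 0" | "i = 0" | "0 < i"
          by linarith
        then show ?thesis
          by cases (use K H in \<open>simp_all only: Waiting sum_queue_neighbours V_simps, auto simp: algebra_simps\<close>)
      qed (use that Choice_Free in simp)
    qed
  qed
qed

end

theorem fact3:
  fixes a b c :: real
  assumes "a > 0" and "b > 0" and "c > 0"
  shows "positive_recurrent (queue_rate a b c) \<longleftrightarrow> c > \<bar>a - b\<bar>"
proof -
  interpret matchmaking a b c
    using assms by unfold_locales
  show ?thesis
    using positive_recurrent_imp_less less_imp_positive_recurrent by blast
qed

end
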